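(* Let $V$ be an $n$-dimensional real vector space, $\{e_1,\dots,e_n\}$ a basis of $V$ and $\{e^1,\dots,e^n\}$ its dual basis. Let $\psi:\mathcal B(V)\to V^{*\otimes3}$ be the linear map defined by $$\psi(B_{ijk}e^i\otimes e^j\otimes e^k)=\frac12(B_{ijk}+B_{jik})\,e^i\otimes e^j\otimes e^k$$ for $B_{ijk}e^i\otimes e^j\otimes e^k\in\mathcal B(V)$. Then $\psi(\mathcal B(V))=\mathcal C(V)$, i.e. the image of $\mathcal B(V)$ under $\psi$ equals $\mathcal C(V)$. Moreover, $\dim\ker\psi=\frac{n(n-1)(n-2)}{6}$.
   Context: Repeated indices are summed. $(0,3)$-tensors are identified with trilinear maps $V\times V\times V\to\mathbb R$. $\mathcal B(V)=\{B\in V^{*\otimes3}: B(u,v,w)=-B(u,w,v)\ \forall u,v,w\in V\}$, i.e. tensors $B_{ijk}e^i\otimes e^j\otimes e^k$ with $B_{ijk}=-B_{ikj}$. $\mathcal C(V)$ is the set of gyroscopic tensors, i.e. $C\in V^{*\otimes3}$ with $C(u,v,w)=C(v,u,w)$ and $C(u,v,w)+C(v,w,u)+C(w,u,v)=0$ for all $u,v,w\in V$; in coordinates $C_{ijk}=C_{jik}$ and $C_{ijk}+C_{jki}+C_{kij}=0$ for all $i,j,k$. *)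

theory Defs
  imports "HOL-Analysis.Analysis" "HOL-Library.Function_Algebras"
begin

(* Covariant tensors are curried functions; this instance makes them a real vector space, so that
   dim and linear from the library apply to spaces of tensors. *)
instantiation "fun" :: (type, real_vector) real_vector
begin

definition scaleR_fun :: "real \<Rightarrow> ('a \<Rightarrow> 'b) \<Rightarrow> 'a \<Rightarrow> 'b" where
  "scaleR_fun c f = (\<lambda>x. c *\<^sub>R f x)"

instance
  by standard (auto simp: scaleR_fun_def fun_eq_iff algebra_simps)

end

type_synonym 'a tensor3 = "'a \<Rightarrow> 'a \<Rightarrow> 'a \<Rightarrow> real"

definition trilinear :: "'a::real_vector tensor3 \<Rightarrow> bool" where
  "trilinear T \<longleftrightarrow>
     (\<forall>v w. linear (\<lambda>u. T u v w)) \<and> (\<forall>u w. linear (\<lambda>v. T u v w)) \<and> (\<forall>u v. linear (\<lambda>w. T u v w))"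

definition B_tensors :: "'a::real_vector tensor3 set" where
  "B_tensors = {B. trilinear B \<and> (\<forall>u v w. B u v w = - B u w v)}"

definition gyroscopic :: "'a::real_vector tensor3 set" where
  "gyroscopic = {C. trilinear C \<and> (\<forall>u v w. C u v w = C v u w) \<and>
     (\<forall>u v w. C u v w + C v w u + C w u v = 0)}"

definition tensor_prod3 :: "('a \<Rightarrow> real) \<Rightarrow> ('a \<Rightarrow> real) \<Rightarrow> ('a \<Rightarrow> real) \<Rightarrow> 'a tensor3" where
  "tensor_prod3 f g h = (\<lambda>u v w. f u * g v * h w)"

definition tensor_of_coords :: "nat \<Rightarrow> (nat \<Rightarrow> 'a \<Rightarrow> real) \<Rightarrow> (nat \<Rightarrow> nat \<Rightarrow> nat \<Rightarrow> real) \<Rightarrow> 'a tensor3" where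
  "tensor_of_coords n \<epsilon> b =
     (\<Sum>i=1..n. \<Sum>j=1..n. \<Sum>k=1..n. b i j k *\<^sub>R tensor_prod3 (\<epsilon> i) (\<epsilon> j) (\<epsilon> k))"

(* The coordinates of B are the numbers B (e i) (e j) (e k), see tensor_of_coords_expand and
   psi_tensor_of_coords. The map is total; its domain of interest is B_tensors. *)
definition psi :: "nat \<Rightarrow> (nat \<Rightarrow> 'a) \<Rightarrow> (nat \<Rightarrow> 'a \<Rightarrow> real) \<Rightarrow> 'a tensor3 \<Rightarrow> 'a tensor3" where
  "psi n e \<epsilon> B =
     tensor_of_coords n \<epsilon> (\<lambda>i j k. 1 / 2 * (B (e i) (e j) (e k) + B (e j) (e i) (e k)))"

lemma sum_fun_apply: "(\<Sum>i\<in>A. f i) x = (\<Sum>i\<in>A. f i x)"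
  by (induction A rule: infinite_finite_induct) auto

lemma tensor_of_coords_apply:
  "tensor_of_coords n \<epsilon> b u v w =
     (\<Sum>i=1..n. \<Sum>j=1..n. \<Sum>k=1..n. b i j k * (\<epsilon> i u * \<epsilon> j v * \<epsilon> k w))"
  by (simp add: tensor_of_coords_def sum_fun_apply scaleR_fun_def tensor_prod3_def)

lemma tensor_of_coords_basis:
  assumes dual: "\<And>i j. i \<in> {1..n} \<Longrightarrow> j \<in> {1..n} \<Longrightarrow> \<epsilon> i (e j) = (if i = j then 1 else 0)"
    and ijk: "i \<in> {1..n}" "j \<in> {1..n}" "k \<in> {1..n}"
  shows "tensor_of_coords n \<epsilon> b (e i) (e j) (e k) = b i j k"
proof -
  have "tensor_of_coords n \<epsilon> b (e i) (e j) (e k) =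
      (\<Sum>p=1..n. \<Sum>q=1..n. \<Sum>r=1..n. if r = k then if q = j then if p = i then b p q r else 0 else 0 else 0)"
    unfolding tensor_of_coords_apply using ijk dual by (intro sum.cong refl) auto
  also have "\<dots> = b i j k"
    using ijk by (simp add: sum.delta)
  finally show ?thesis .
qed

lemma tensor_of_coords_expand:
  fixes e :: "nat \<Rightarrow> 'a::real_vector"
  assumes span: "span (e ` {1..n}) = UNIV"
    and lin: "\<And>i. i \<in> {1..n} \<Longrightarrow> linear (\<epsilon> i)"
    and dual: "\<And>i j. i \<in> {1..n} \<Longrightarrow> j \<in> {1..n} \<Longrightarrow> \<epsilon> i (e j) = (if i = j then 1 else 0)"
    and T: "trilinear T"
  shows "T = tensor_of_coords n \<epsilon> (\<lambda>i j k. T (e i) (e j) (e k))"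
proof -
  have expand: "f v = (\<Sum>i=1..n. f (e i) * \<epsilon> i v)" if f: "linear f" for f :: "'a \<Rightarrow> real" and v
  proof (rule linear_eq_on[of f "\<lambda>v. \<Sum>i=1..n. f (e i) * \<epsilon> i v" v "e ` {1..n}"])
    show "linear f" by (fact f)
    show "linear (\<lambda>v. \<Sum>i=1..n. f (e i) * \<epsilon> i v)"
      using lin by (auto simp: linear_iff sum.distrib[symmetric] sum_distrib_left algebra_simps
          intro!: sum.cong)
    show "v \<in> span (e ` {1..n})" using span by simp
    fix b assume "b \<in> e ` {1..n}"
    then obtain j where j: "j \<in> {1..n}" "b = e j" by blast
    have "(\<Sum>i=1..n. f (e i) * \<epsilon> i b) = (\<Sum>i=1..n. if i = j then f (e i) else 0)"
      using j dual by (intro sum.cong refl) auto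
    then show "f b = (\<Sum>i=1..n. f (e i) * \<epsilon> i b)" using j by simp
  qed
  have "T u v w = tensor_of_coords n \<epsilon> (\<lambda>i j k. T (e i) (e j) (e k)) u v w" for u v w
  proof -
    have "T u v w = (\<Sum>i=1..n. T (e i) v w * \<epsilon> i u)"
      using T by (intro expand) (simp add: trilinear_def)
    also have "\<dots> = (\<Sum>i=1..n. (\<Sum>j=1..n. T (e i) (e j) w * \<epsilon> j v) * \<epsilon> i u)"
      using T by (intro sum.cong refl arg_cong2[where f="(*)"] expand) (simp add: trilinear_def)
    also have "\<dots> = (\<Sum>i=1..n. (\<Sum>j=1..n. (\<Sum>k=1..n. T (e i) (e j) (e k) * \<epsilon> k w) * \<epsilon> j v) * \<epsilon> i u)"
      using T by (intro sum.cong refl arg_cong2[where f="(*)"] expand) (simp add: trilinear_def)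
    also have "\<dots> = tensor_of_coords n \<epsilon> (\<lambda>i j k. T (e i) (e j) (e k)) u v w"
      by (simp add: tensor_of_coords_apply sum_distrib_left sum_distrib_right mult_ac)
    finally show ?thesis .
  qed
  then show ?thesis by (intro ext)
qed

lemma psi_tensor_of_coords:
  assumes "\<And>i j. i \<in> {1..n} \<Longrightarrow> j \<in> {1..n} \<Longrightarrow> \<epsilon> i (e j) = (if i = j then 1 else 0)"
  shows "psi n e \<epsilon> (tensor_of_coords n \<epsilon> b) =
    tensor_of_coords n \<epsilon> (\<lambda>i j k. 1 / 2 * (b i j k + b j i k))"
proof -
  have "tensor_of_coords n \<epsilon> b (e i) (e j) (e k) = b i j k"
    if "i \<in> {1..n}" "j \<in> {1..n}" "k \<in> {1..n}" for i j k
    using assms that by (rule tensor_of_coords_basis)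
  then show ?thesis
    by (subst psi_def, unfold tensor_of_coords_def[of n \<epsilon> "\<lambda>i j k. 1 / 2 * f i j k" for f])
      (intro sum.cong refl, simp)
qed

lemma linear_psi: "linear (psi n e \<epsilon>)"
  unfolding linear_iff psi_def
  by (auto simp: fun_eq_iff tensor_of_coords_apply scaleR_fun_def sum.distrib[symmetric]
      sum_distrib_left algebra_simps intro!: sum.cong)

end

theory Submission
  imports Defs
begin

text \<open>
  On trilinear tensors the map is coordinate free: it sends \<open>B\<close> to half the sum of \<open>B(u,v,w)\<close> and
  \<open>B(v,u,w)\<close>, that is, it symmetrises the first two slots (\<open>psi_trilinear\<close>).

  Image. When \<open>B\<close> is skew in the last two slots, the six terms of the cyclic sum of \<open>\<psi>(B)\<close>
  cancel in pairs, so \<open>\<psi>(B)\<close> is gyroscopic. Conversely, for a gyroscopic \<open>C\<close> the tensor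
  \<open>2/3 (C(u,v,w) - C(u,w,v))\<close> is a preimage of \<open>C\<close>: symmetrising produces a multiple of
  \<open>2 C(u,v,w) - C(v,w,u) - C(w,u,v)\<close>, and the cyclic identity turns this into \<open>3 C(u,v,w)\<close>.

  Kernel. Skewness in the last two slots together with \<open>\<psi>(B) = 0\<close>, which is skewness in the first
  two slots, says that \<open>B\<close> is alternating. An alternating tensor is determined by its values on
  the basis triples with \<open>i < j < k\<close>, and the wedge products of the dual basis covectors with such
  indices realise these values independently (\<open>wedge3_dual_basis\<close>). They therefore form a basis of the
  kernel, and the number of these triples is the binomial coefficient of \<open>n\<close> over 3.
\<close>

section \<open>The map without coordinates\<close>

lemma trilinearD:
  assumes "trilinear T"
  shows "T (u + u') v w = T u v w + T u' v w" "T (c *\<^sub>R u) v w = c * T u v w"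
    "T u (v + v') w = T u v w + T u v' w" "T u (c *\<^sub>R v) w = c * T u v w"
    "T u v (w + w') = T u v w + T u v w'" "T u v (c *\<^sub>R w) = c * T u v w"
  using assms unfolding trilinear_def linear_iff by auto

lemma psi_trilinear:
  fixes e :: "nat \<Rightarrow> 'a::real_vector" and \<epsilon> :: "nat \<Rightarrow> 'a \<Rightarrow> real"
  assumes span: "span (e ` {1..n}) = UNIV"
    and lin: "\<And>i. i \<in> {1..n} \<Longrightarrow> linear (\<epsilon> i)"
    and dual: "\<And>i j. i \<in> {1..n} \<Longrightarrow> j \<in> {1..n} \<Longrightarrow> \<epsilon> i (e j) = (if i = j then 1 else 0)"
    and T: "trilinear T"
  shows "psi n e \<epsilon> T = (\<lambda>u v w. 1 / 2 * (T u v w + T v u w))"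
proof -
  let ?S = "\<lambda>u v w. 1 / 2 * (T u v w + T v u w)"
  have "trilinear ?S"
    unfolding trilinear_def linear_iff by (auto simp: trilinearD[OF T] algebra_simps)
  from tensor_of_coords_expand[OF span lin dual this] show ?thesis
    by (simp add: psi_def)
qed

section \<open>The image\<close>

lemma symmetrisation_gyroscopic:
  assumes "B \<in> B_tensors"
  shows "(\<lambda>u v w. 1 / 2 * (B u v w + B v u w)) \<in> gyroscopic"
proof -
  have T: "trilinear B" and skew: "\<And>u v w. B u v w = - B u w v"
    using assms unfolding B_tensors_def by blast+
  have "trilinear (\<lambda>u v w. 1 / 2 * (B u v w + B v u w))"
    unfolding trilinear_def linear_iff by (auto simp: trilinearD[OF T] algebra_simps)
  moreover have "1 / 2 * (B u v w + B v u w) + 1 / 2 * (B v w u + B w v u)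
      + 1 / 2 * (B w u v + B u w v) = 0" for u v w
    using skew[of u v w] skew[of v w u] skew[of w u v] by argo
  ultimately show ?thesis
    unfolding gyroscopic_def by auto
qed

lemma gyroscopic_preimage:
  assumes "C \<in> gyroscopic"
  defines "B \<equiv> \<lambda>u v w. 2 / 3 * (C u v w - C u w v)"
  shows "B \<in> B_tensors" "(\<lambda>u v w. 1 / 2 * (B u v w + B v u w)) = C"
proof -
  have T: "trilinear C" and sym: "\<And>u v w. C u v w = C v u w"
    and cyc: "\<And>u v w. C u v w + C v w u + C w u v = 0"
    using assms(1) unfolding gyroscopic_def by blast+
  have "trilinear B"
    unfolding trilinear_def linear_iff B_def by (auto simp: trilinearD[OF T] algebra_simps)
  then show "B \<in> B_tensors"
    unfolding B_tensors_def by (simp add: B_def field_simps)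
  have "1 / 2 * (B u v w + B v u w) = C u v w" for u v w
    using cyc[of u v w] sym[of v u w] sym[of u w v] unfolding B_def by argo
  then show "(\<lambda>u v w. 1 / 2 * (B u v w + B v u w)) = C"
    by (intro ext)
qed

section \<open>Alternating tensors\<close>

definition alternating3 :: "'a::real_vector tensor3 set" where
  "alternating3 = {T. trilinear T \<and> (\<forall>u v w. T u v w = - T v u w) \<and> (\<forall>u v w. T u v w = - T u w v)}"

lemma subspace_alternating3: "subspace (alternating3 :: 'a::real_vector tensor3 set)"
  unfolding subspace_def
proof (intro conjI ballI allI)
  show "(0 :: 'a tensor3) \<in> alternating3"
    unfolding alternating3_def trilinear_def linear_iff by auto
next
  fix S T :: "'a tensor3"
  assume "S \<in> alternating3" "T \<in> alternating3"
  then have S: "trilinear S" "\<And>u v w. S u v w = - S v u w" "\<And>u v w. S u v w = - S u w v"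
    and T: "trilinear T" "\<And>u v w. T u v w = - T v u w" "\<And>u v w. T u v w = - T u w v"
    unfolding alternating3_def by blast+
  have "trilinear (S + T)"
    unfolding trilinear_def linear_iff
    by (auto simp: trilinearD[OF S(1)] trilinearD[OF T(1)] algebra_simps)
  moreover have "(S + T) u v w = - (S + T) v u w" "(S + T) u v w = - (S + T) u w v" for u v w
    using S(2,3)[of u v w] T(2,3)[of u v w] by simp_all
  ultimately show "S + T \<in> alternating3"
    unfolding alternating3_def by blast
next
  fix c and T :: "'a tensor3"
  assume "T \<in> alternating3"
  then have T: "trilinear T" "\<And>u v w. T u v w = - T v u w" "\<And>u v w. T u v w = - T u w v"
    unfolding alternating3_def by blast+
  have "trilinear (c *\<^sub>R T)"
    unfolding trilinear_def linear_iff
    by (auto simp: scaleR_fun_def trilinearD[OF T(1)] algebra_simps)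
  moreover have "(c *\<^sub>R T) u v w = - (c *\<^sub>R T) v u w" "(c *\<^sub>R T) u v w = - (c *\<^sub>R T) u w v" for u v w
    using T(2,3)[of u v w] by (simp_all add: scaleR_fun_def)
  ultimately show "c *\<^sub>R T \<in> alternating3"
    unfolding alternating3_def by blast
qed

definition increasing_triples :: "nat \<Rightarrow> (nat \<times> nat \<times> nat) set" where
  "increasing_triples n = {(i, j, k). 1 \<le> i \<and> i < j \<and> j < k \<and> k \<le> n}"

lemma finite_increasing_triples: "finite (increasing_triples n)"
  by (rule finite_subset[of _ "{1..n} \<times> {1..n} \<times> {1..n}"]) (auto simp: increasing_triples_def)

text \<open>
  An alternating tensor vanishes when two arguments agree, and otherwise a permutation sorts the
  indices at the cost of a sign; so its coordinates, and hence the tensor, are determined by the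
  sorted index triples.
\<close>

lemma alternating3_eqI:
  fixes e :: "nat \<Rightarrow> 'a::real_vector" and \<epsilon> :: "nat \<Rightarrow> 'a \<Rightarrow> real"
  assumes span: "span (e ` {1..n}) = UNIV"
    and lin: "\<And>i. i \<in> {1..n} \<Longrightarrow> linear (\<epsilon> i)"
    and dual: "\<And>i j. i \<in> {1..n} \<Longrightarrow> j \<in> {1..n} \<Longrightarrow> \<epsilon> i (e j) = (if i = j then 1 else 0)"
    and S: "S \<in> alternating3" and T: "T \<in> alternating3"
    and eq: "\<And>i j k. (i, j, k) \<in> increasing_triples n \<Longrightarrow> S (e i) (e j) (e k) = T (e i) (e j) (e k)"
  shows "S = T"
proof -
  have tri: "trilinear S" "trilinear T"
    using S T unfolding alternating3_def by blast+
  have skew: "S u v w = - S v u w" "S u v w = - S u w v"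
      "T u v w = - T v u w" "T u v w = - T u w v" for u v w
    using S T unfolding alternating3_def by blast+
  have repeated: "S u u w = 0" "S u w w = 0" "S u w u = 0" "T u u w = 0" "T u w w = 0" "T u w u = 0"
    for u w
    using skew[of u u w] skew[of u w w] skew[of u w u] skew[of w u u] by linarith+
  have coords: "S (e i) (e j) (e k) = T (e i) (e j) (e k)"
    if "i \<in> {1..n}" "j \<in> {1..n}" "k \<in> {1..n}" for i j k
  proof -
    consider "i = j" | "j = k" | "i = k" | "i < j" "j < k" | "i < k" "k < j" | "j < i" "i < k"
      | "j < k" "k < i" | "k < i" "i < j" | "k < j" "j < i"
      by linarith
    then show ?thesis
    proof cases
      case 4
      then show ?thesis using that eq[of i j k] by (simp add: increasing_triples_def)
    next
      case 5
      then have "S (e i) (e k) (e j) = T (e i) (e k) (e j)"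
        using that by (intro eq) (simp add: increasing_triples_def)
      then show ?thesis using skew[of "e i" "e j" "e k"] by linarith
    next
      case 6
      then have "S (e j) (e i) (e k) = T (e j) (e i) (e k)"
        using that by (intro eq) (simp add: increasing_triples_def)
      then show ?thesis using skew[of "e i" "e j" "e k"] by linarith
    next
      case 7
      then have "S (e j) (e k) (e i) = T (e j) (e k) (e i)"
        using that by (intro eq) (simp add: increasing_triples_def)
      then show ?thesis
        using skew[of "e i" "e j" "e k"] skew[of "e j" "e i" "e k"] by linarith
    next
      case 8
      then have "S (e k) (e i) (e j) = T (e k) (e i) (e j)"
        using that by (intro eq) (simp add: increasing_triples_def)
      then show ?thesis
        using skew[of "e i" "e j" "e k"] skew[of "e i" "e k" "e j"] by linarith
    next
      case 9
      then have "S (e k) (e j) (e i) = T (e k) (e j) (e i)"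
        using that by (intro eq) (simp add: increasing_triples_def)
      then show ?thesis
        using skew[of "e i" "e j" "e k"] skew[of "e j" "e i" "e k"] skew[of "e j" "e k" "e i"]
        by linarith
    qed (simp_all add: repeated)
  qed
  have "S = tensor_of_coords n \<epsilon> (\<lambda>i j k. S (e i) (e j) (e k))"
    by (rule tensor_of_coords_expand[OF span lin dual tri(1)])
  also have "\<dots> = tensor_of_coords n \<epsilon> (\<lambda>i j k. T (e i) (e j) (e k))"
    unfolding tensor_of_coords_def by (intro sum.cong refl) (simp add: coords)
  also have "\<dots> = T"
    by (rule tensor_of_coords_expand[OF span lin dual tri(2), symmetric])
  finally show ?thesis .
qed

section \<open>Wedge products of covectors\<close>

text \<open>
  The determinant of the \<open>3 \<times> 3\<close> matrix of the values of \<open>f\<close>, \<open>g\<close>, \<open>h\<close> at \<open>u\<close>, \<open>v\<close>, \<open>w\<close>.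
  This normalisation, without a factor \<open>1/6\<close>, gives the value 1 on the matching basis triple.
\<close>

definition wedge3 :: "('a \<Rightarrow> real) \<Rightarrow> ('a \<Rightarrow> real) \<Rightarrow> ('a \<Rightarrow> real) \<Rightarrow> 'a tensor3" where
  "wedge3 f g h = (\<lambda>u v w.
     f u * (g v * h w - g w * h v) - f v * (g u * h w - g w * h u) + f w * (g u * h v - g v * h u))"

lemma wedge3_alternating3:
  assumes "linear f" "linear g" "linear h"
  shows "wedge3 f g h \<in> alternating3"
  using assms unfolding alternating3_def trilinear_def linear_iff wedge3_def
  by (auto simp: algebra_simps)

text \<open>
  For two distinct sorted triples some index of the first is missing from the second, which gives
  the matrix in the determinant a zero row; for equal ones it is the identity matrix.
\<close>

lemma wedge3_dual_basis:
  fixes \<epsilon> :: "nat \<Rightarrow> 'a \<Rightarrow> real"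
  assumes dual: "\<And>i j. i \<in> {1..n} \<Longrightarrow> j \<in> {1..n} \<Longrightarrow> \<epsilon> i (e j) = (if i = j then 1 else 0)"
    and p: "(i, j, k) \<in> increasing_triples n" and q: "(a, b, c) \<in> increasing_triples n"
  shows "wedge3 (\<epsilon> i) (\<epsilon> j) (\<epsilon> k) (e a) (e b) (e c) = (if (i, j, k) = (a, b, c) then 1 else 0)"
proof -
  have "x \<in> {1..n}" if "x \<in> {i, j, k, a, b, c}" for x
    using p q that by (auto simp: increasing_triples_def)
  then have "\<epsilon> x (e y) = (if x = y then 1 else 0)" if "x \<in> {i, j, k}" "y \<in> {a, b, c}" for x y
    using dual that by blast
  then show ?thesis
    using p q unfolding wedge3_def increasing_triples_def by auto
qed

text \<open>
  A family with a biorthogonal family of functionals is linearly independent: applying the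
  functional of one index to a linear relation isolates the coefficient at that index.
\<close>

lemma biorthogonal_independent:
  fixes E :: "'i \<Rightarrow> 'v::real_vector" and \<phi> :: "'i \<Rightarrow> 'v \<Rightarrow> real"
  assumes fin: "finite I"
    and lin: "\<And>p. p \<in> I \<Longrightarrow> linear (\<phi> p)"
    and bi: "\<And>p q. p \<in> I \<Longrightarrow> q \<in> I \<Longrightarrow> \<phi> p (E q) = (if p = q then 1 else 0)"
  shows "inj_on E I" "independent (E ` I)"
proof -
  show inj: "inj_on E I"
  proof (rule inj_onI)
    fix p q
    assume "p \<in> I" "q \<in> I" "E p = E q"
    then show "p = q" using bi[of p p] bi[of p q] by (auto split: if_splits)
  qed
  show "independent (E ` I)"
  proof (rule independent_if_scalars_zero)
    show "finite (E ` I)" using fin by simp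
    fix c x
    assume rel: "(\<Sum>x\<in>E ` I. c x *\<^sub>R x) = 0" and "x \<in> E ` I"
    then obtain p where p: "p \<in> I" "x = E p" by blast
    have "0 = \<phi> p (\<Sum>q\<in>I. c (E q) *\<^sub>R E q)"
      using rel inj lin[OF p(1)] by (simp add: sum.reindex linear_0)
    also have "\<dots> = (\<Sum>q\<in>I. c (E q) * \<phi> p (E q))"
      using lin[OF p(1)] by (simp add: linear_sum linear_scale)
    also have "\<dots> = (\<Sum>q\<in>I. if q = p then c (E q) else 0)"
      using bi p(1) by (intro sum.cong refl) auto
    also have "\<dots> = c x"
      using fin p by simp
    finally show "c x = 0" by simp
  qed
qed

text \<open>
  The new triples when \<open>n\<close> grows by one are those ending in \<open>n + 1\<close>. Their first two entries form
  an increasing pair below \<open>n + 1\<close>, and such pairs are counted by the same recursion. The closed form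
  has real subtractions, so that it covers \<open>n < 2\<close> as well.
\<close>

lemma card_increasing_triples:
  "real (card (increasing_triples n)) = real n * (real n - 1) * (real n - 2) / 6"
proof (induction n)
  case 0
  have "increasing_triples 0 = {}"
    by (auto simp: increasing_triples_def)
  then show ?case by simp
next
  case (Suc n)
  define P where "P m = {(i, j). 1 \<le> i \<and> i < j \<and> j \<le> m}" for m :: nat
  have finite_P: "finite (P m)" for m
    by (rule finite_subset[of _ "{1..m} \<times> {1..m}"]) (auto simp: P_def)
  have card_P: "real (card (P m)) = real m * (real m - 1) / 2" for m
  proof (induction m)
    case 0
    have "P 0 = {}" by (auto simp: P_def)
    then show ?case by simp
  next
    case (Suc m)
    have "P (Suc m) = P m \<union> {1..m} \<times> {Suc m}"
      by (auto simp: P_def)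
    moreover have "P m \<inter> {1..m} \<times> {Suc m} = {}"
      by (auto simp: P_def)
    ultimately have "card (P (Suc m)) = card (P m) + m"
      using finite_P[of m] by (simp add: card_Un_disjoint)
    then show ?case using Suc by (simp add: field_simps)
  qed
  let ?top = "(\<lambda>(i, j). (i, j, Suc n)) ` P n"
  have "increasing_triples (Suc n) = increasing_triples n \<union> ?top"
    by (auto simp: increasing_triples_def P_def le_Suc_eq)
  moreover have "increasing_triples n \<inter> ?top = {}"
    by (auto simp: increasing_triples_def)
  moreover have "card ?top = card (P n)"
    by (rule card_image) (auto simp: inj_on_def)
  ultimately have "card (increasing_triples (Suc n)) = card (increasing_triples n) + card (P n)"
    using finite_P[of n] finite_increasing_triples[of n] by (simp add: card_Un_disjoint)
  then show ?case using Suc card_P[of n] by (simp add: field_simps)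
qed

text \<open>
  The wedges of dual basis covectors are biorthogonal to evaluation at sorted basis triples, hence
  independent. They span because the combination with the sorted coordinates of \<open>T\<close> as coefficients
  is an alternating tensor with the same sorted coordinates as \<open>T\<close>.
\<close>

lemma dim_alternating3:
  fixes e :: "nat \<Rightarrow> 'a::real_vector" and \<epsilon> :: "nat \<Rightarrow> 'a \<Rightarrow> real"
  assumes span: "span (e ` {1..n}) = UNIV"
    and lin: "\<And>i. i \<in> {1..n} \<Longrightarrow> linear (\<epsilon> i)"
    and dual: "\<And>i j. i \<in> {1..n} \<Longrightarrow> j \<in> {1..n} \<Longrightarrow> \<epsilon> i (e j) = (if i = j then 1 else 0)"
  shows "dim (alternating3 :: 'a tensor3 set) = card (increasing_triples n)"
proof -
  define I where "I = increasing_triples n"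
  define E where "E = (\<lambda>(i, j, k). wedge3 (\<epsilon> i) (\<epsilon> j) (\<epsilon> k))"
  define \<phi> where "\<phi> = (\<lambda>(i, j, k) (T :: 'a tensor3). T (e i) (e j) (e k))"
  have fin: "finite I"
    by (simp add: I_def finite_increasing_triples)
  have lin_\<phi>: "linear (\<phi> p)" for p
    by (cases p) (simp add: \<phi>_def linear_iff scaleR_fun_def)
  have bi: "\<phi> p (E q) = (if p = q then 1 else 0)" if "p \<in> I" "q \<in> I" for p q
  proof -
    obtain i j k a b c where [simp]: "p = (i, j, k)" "q = (a, b, c)"
      by (metis prod_cases3)
    have "wedge3 (\<epsilon> a) (\<epsilon> b) (\<epsilon> c) (e i) (e j) (e k) = (if (a, b, c) = (i, j, k) then 1 else 0)"
      using dual that by (intro wedge3_dual_basis[where n = n]) (auto simp: I_def)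
    then show ?thesis
      by (simp add: E_def \<phi>_def eq_commute)
  qed
  have alt: "E p \<in> alternating3" if "p \<in> I" for p
    using that lin by (auto simp: I_def E_def increasing_triples_def intro!: wedge3_alternating3)
  have "T \<in> span (E ` I)" if T: "T \<in> alternating3" for T
  proof -
    define S where "S = (\<Sum>p\<in>I. \<phi> p T *\<^sub>R E p)"
    have "\<phi> q T = \<phi> q S" if "q \<in> I" for q
    proof -
      have "\<phi> q S = (\<Sum>p\<in>I. \<phi> p T * \<phi> q (E p))"
        unfolding S_def by (simp add: linear_sum[OF lin_\<phi>] linear_scale[OF lin_\<phi>])
      also have "\<dots> = (\<Sum>p\<in>I. if p = q then \<phi> p T else 0)"
        using bi that by (intro sum.cong refl) auto
      finally show ?thesis using fin that by simp
    qed
    moreover have "S \<in> alternating3"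
      unfolding S_def using alt
      by (intro subspace_sum subspace_scale subspace_alternating3)
    ultimately have "T = S"
      using T by (intro alternating3_eqI[OF span lin dual]) (auto simp: \<phi>_def I_def)
    moreover have "S \<in> span (E ` I)"
      unfolding S_def by (intro span_sum span_scale span_base imageI)
    ultimately show ?thesis by simp
  qed
  moreover have "inj_on E I" "independent (E ` I)"
    using biorthogonal_independent[OF fin, of \<phi> E] lin_\<phi> bi by blast+
  ultimately show ?thesis
    using alt by (intro dim_unique[of "E ` I"]) (auto simp: card_image I_def)
qed

section \<open>Image and kernel\<close>

theorem lemma2:
  fixes n :: nat and e :: "nat \<Rightarrow> 'a::real_vector" and \<epsilon> :: "nat \<Rightarrow> 'a \<Rightarrow> real"
  assumes basis: "inj_on e {1..n}" "independent (e ` {1..n})" "span (e ` {1..n}) = UNIV"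
    and dual_linear: "\<And>i. i \<in> {1..n} \<Longrightarrow> linear (\<epsilon> i)"
    and dual_basis: "\<And>i j. i \<in> {1..n} \<Longrightarrow> j \<in> {1..n} \<Longrightarrow> \<epsilon> i (e j) = (if i = j then 1 else 0)"
  shows "psi n e \<epsilon> ` B_tensors = gyroscopic \<and>
    real (dim {B \<in> B_tensors. psi n e \<epsilon> B = 0}) = real n * (real n - 1) * (real n - 2) / 6"
proof
  have psi: "psi n e \<epsilon> B = (\<lambda>u v w. 1 / 2 * (B u v w + B v u w))" if "B \<in> B_tensors" for B
    using that by (intro psi_trilinear basis(3) dual_linear dual_basis) (simp_all add: B_tensors_def)
  show "psi n e \<epsilon> ` B_tensors = gyroscopic"
  proof (intro set_eqI iffI)
    fix C
    assume "C \<in> psi n e \<epsilon> ` B_tensors"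
    then show "C \<in> gyroscopic"
      using psi symmetrisation_gyroscopic by auto
  next
    fix C :: "'a tensor3"
    assume "C \<in> gyroscopic"
    note pre = gyroscopic_preimage[OF this]
    show "C \<in> psi n e \<epsilon> ` B_tensors"
      by (rule image_eqI[OF _ pre(1)]) (simp only: psi[OF pre(1)] pre(2))
  qed
  have "psi n e \<epsilon> B = 0 \<longleftrightarrow> (\<forall>u v w. B u v w = - B v u w)" if "B \<in> B_tensors" for B
    unfolding psi[OF that] by (simp add: fun_eq_iff eq_neg_iff_add_eq_0)
  then have "{B \<in> B_tensors. psi n e \<epsilon> B = 0} = (alternating3 :: 'a tensor3 set)"
    unfolding alternating3_def B_tensors_def by blast
  then show "real (dim {B \<in> B_tensors. psi n e \<epsilon> B = 0}) = real n * (real n - 1) * (real n - 2) / 6"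
    using dim_alternating3[where e = e and \<epsilon> = \<epsilon>, OF basis(3) dual_linear dual_basis]
    by (simp add: card_increasing_triples)
qed

end
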